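(* Let $\mathcal C$ be a category and let $\{[N_i,d_i]\}_{i\in I}$ be a center in $\mathcal C$. Assume that, for all $i\in I$, $N_i$ is the sieve $S^{\mathcal C}_{Id_{cod(d_i)}}$ of all morphisms of $\mathcal C$ with codomain $cod(d_i)$. Then the dilatation $\mathcal C\left[\{(d_i)^{-1}\circ N_i\}_{i\in I}\right]$ is the localization $\mathcal C[(\{d_i\}_{i\in I})^{-1}]$.
   Context: A sieve in $\mathcal C$ is a collection of morphisms stable under precomposition; a sieve over an object $Y$ is a sieve all of whose morphisms have codomain $Y$. Localization. For a collection $\Sigma$ of morphisms of $\mathcal C$, let $\mathcal G$ be the directed graph whose vertices are the objects of $\mathcal C$ and whose directed lines are: a line $a:dom(a)\to cod(a)$ for each morphism $a$ of $\mathcal C$, and a line $l_d:cod(d)\to dom(d)$ for each $d\in\Sigma$. A $\Sigma$-sequence is a finite, possibly empty, path of composable directed lines of $\mathcal G$ (an empty sequence is given by an object). Two $\Sigma$-sequences with the same domain and codomain are equivalent if they are related by a chain of replacements of consecutive parts (written in order of traversal): $X\xrightarrow{a}Y\xrightarrow{a'}Z \leftrightsquigarrow X\xrightarrow{a'\circ a}Z$ for $a,a'\in Mor\,\mathcal C$; $l_d,d\leftrightsquigarrow$ empty and $d,l_d\leftrightsquigarrow$ empty for $d\in\Sigma$; $Id_X\leftrightsquigarrow$ empty sequence at $X$. The class of $s$ is denoted $[s]$; a $\Sigma$-fraction is such a class. The localization $\mathcal C[\Sigma^{-1}]$ has the objects of $\mathcal C$ as objects and $\Sigma$-fractions as morphisms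 (composed by concatenation). Dilatation. A center in $\mathcal C$ is a collection $\{[N_i,d_i]\}_{i\in I}$ where each $d_i$ is a morphism of $\mathcal C$ and $N_i$ is a sieve over $cod(d_i)$. Put $\Sigma=\{d_i\}_{i\in I}$. A $\{[N_i,d_i]\}_{i\in I}$-fraction is a $\Sigma$-fraction having a representative of the form $X_1\xrightarrow{n_1}Y_1\xrightarrow{l_{d_{i_1}}}X_2\xrightarrow{n_2}Y_2\xrightarrow{l_{d_{i_2}}}X_3\cdots X_k\xrightarrow{n_k}Y_k\xrightarrow{l_{d_{i_k}}}X_{k+1}\xrightarrow{a}X_{k+2}$ with $a\in Mor\,\mathcal C$, $k\ge 0$, $i_j\in I$ and $n_j\in N_{i_j}$ for all $j$. The dilatation $\mathcal C\left[\{(d_i)^{-1}\circ N_i\}_{i\in I}\right]$ is the category with the same objects as $\mathcal C$ and with $\{[N_i,d_i]\}_{i\in I}$-fractions as morphisms (composed by concatenation). Regarding $\{[N_i,d_i]\}_{i\in I}$-fractions as $\Sigma$-fractions gives a faithful functor $\mathcal C\left[\{(d_i)^{-1}\circ N_i\}_{i\in I}\right]\to\mathcal C[\Sigma^{-1}]$ that is the identity on objects; "is the localization" means that this functor is also full (hence an identity of categories). *)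

theory Defs
  imports Main
begin

record ('o, 'm) cat_data =
  Obj :: "'o set"
  Mor :: "'m set"
  Dom :: "'m \<Rightarrow> 'o"
  Cod :: "'m \<Rightarrow> 'o"
  Ident :: "'o \<Rightarrow> 'm"
  Comp :: "'m \<Rightarrow> 'm \<Rightarrow> 'm" \<comment> \<open>\<open>Comp C g f\<close> is \<open>g\<close> after \<open>f\<close>\<close>

locale category =
  fixes C :: "('o, 'm) cat_data"
  assumes Dom_in: "f \<in> Mor C \<Longrightarrow> Dom C f \<in> Obj C"
    and Cod_in: "f \<in> Mor C \<Longrightarrow> Cod C f \<in> Obj C"
    and Ident_in: "X \<in> Obj C \<Longrightarrow> Ident C X \<in> Mor C"
    and Dom_Ident: "X \<in> Obj C \<Longrightarrow> Dom C (Ident C X) = X"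
    and Cod_Ident: "X \<in> Obj C \<Longrightarrow> Cod C (Ident C X) = X"
    and Comp_in: "\<lbrakk>f \<in> Mor C; g \<in> Mor C; Cod C f = Dom C g\<rbrakk> \<Longrightarrow> Comp C g f \<in> Mor C"
    and Dom_Comp: "\<lbrakk>f \<in> Mor C; g \<in> Mor C; Cod C f = Dom C g\<rbrakk> \<Longrightarrow> Dom C (Comp C g f) = Dom C f"
    and Cod_Comp: "\<lbrakk>f \<in> Mor C; g \<in> Mor C; Cod C f = Dom C g\<rbrakk> \<Longrightarrow> Cod C (Comp C g f) = Cod C g"
    and Comp_Ident: "f \<in> Mor C \<Longrightarrow> Comp C f (Ident C (Dom C f)) = f"
    and Ident_Comp: "f \<in> Mor C \<Longrightarrow> Comp C (Ident C (Cod C f)) f = f"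
    and Comp_assoc: "\<lbrakk>f \<in> Mor C; g \<in> Mor C; h \<in> Mor C; Cod C f = Dom C g; Cod C g = Dom C h\<rbrakk>
      \<Longrightarrow> Comp C h (Comp C g f) = Comp C (Comp C h g) f"

locale cat_functor = A: category A + B: category B
  for A :: "('o, 'm) cat_data" and B :: "('p, 'n) cat_data" +
  fixes Fo :: "'o \<Rightarrow> 'p" and Fm :: "'m \<Rightarrow> 'n"
  assumes Fo_in: "X \<in> Obj A \<Longrightarrow> Fo X \<in> Obj B"
    and Fm_in: "f \<in> Mor A \<Longrightarrow> Fm f \<in> Mor B"
    and Dom_Fm: "f \<in> Mor A \<Longrightarrow> Dom B (Fm f) = Fo (Dom A f)"
    and Cod_Fm: "f \<in> Mor A \<Longrightarrow> Cod B (Fm f) = Fo (Cod A f)"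
    and Fm_Ident: "X \<in> Obj A \<Longrightarrow> Fm (Ident A X) = Ident B (Fo X)"
    and Fm_Comp: "\<lbrakk>f \<in> Mor A; g \<in> Mor A; Cod A f = Dom A g\<rbrakk>
      \<Longrightarrow> Fm (Comp A g f) = Comp B (Fm g) (Fm f)"

definition Hom :: "('o, 'm) cat_data \<Rightarrow> 'o \<Rightarrow> 'o \<Rightarrow> 'm set" where
  "Hom C X Y = {f \<in> Mor C. Dom C f = X \<and> Cod C f = Y}"

definition faithful_functor ::
  "('o, 'm) cat_data \<Rightarrow> ('p, 'n) cat_data \<Rightarrow> ('o \<Rightarrow> 'p) \<Rightarrow> ('m \<Rightarrow> 'n) \<Rightarrow> bool" where
  "faithful_functor A B Fo Fm \<longleftrightarrow> cat_functor A B Fo Fm \<and>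
     (\<forall>X \<in> Obj A. \<forall>Y \<in> Obj A. inj_on Fm (Hom A X Y))"

definition full_functor ::
  "('o, 'm) cat_data \<Rightarrow> ('p, 'n) cat_data \<Rightarrow> ('o \<Rightarrow> 'p) \<Rightarrow> ('m \<Rightarrow> 'n) \<Rightarrow> bool" where
  "full_functor A B Fo Fm \<longleftrightarrow> cat_functor A B Fo Fm \<and>
     (\<forall>X \<in> Obj A. \<forall>Y \<in> Obj A. Fm ` Hom A X Y = Hom B (Fo X) (Fo Y))"

definition sieve :: "('o, 'm) cat_data \<Rightarrow> 'm set \<Rightarrow> bool" where
  "sieve C S \<longleftrightarrow> S \<subseteq> Mor C \<and>
     (\<forall>n \<in> S. \<forall>f \<in> Mor C. Cod C f = Dom C n \<longrightarrow> Comp C n f \<in> S)"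

definition sieve_over :: "('o, 'm) cat_data \<Rightarrow> 'o \<Rightarrow> 'm set \<Rightarrow> bool" where
  "sieve_over C Y S \<longleftrightarrow> sieve C S \<and> (\<forall>n \<in> S. Cod C n = Y)"

definition maximal_sieve :: "('o, 'm) cat_data \<Rightarrow> 'o \<Rightarrow> 'm set" where
  "maximal_sieve C Y = {f \<in> Mor C. Cod C f = Y}"


section \<open>Localization\<close>

datatype 'm line = Fwd 'm | Bwd 'm \<comment> \<open>\<open>Bwd d\<close> is the formal inverse \<open>l_d\<close> of \<open>d\<close>\<close>

fun line_dom :: "('o, 'm) cat_data \<Rightarrow> 'm line \<Rightarrow> 'o" where
  "line_dom C (Fwd a) = Dom C a"
| "line_dom C (Bwd d) = Cod C d"

fun line_cod :: "('o, 'm) cat_data \<Rightarrow> 'm line \<Rightarrow> 'o" where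
  "line_cod C (Fwd a) = Cod C a"
| "line_cod C (Bwd d) = Dom C d"

fun is_line :: "('o, 'm) cat_data \<Rightarrow> 'm set \<Rightarrow> 'm line \<Rightarrow> bool" where
  "is_line C \<Sigma> (Fwd a) \<longleftrightarrow> a \<in> Mor C"
| "is_line C \<Sigma> (Bwd d) \<longleftrightarrow> d \<in> \<Sigma>"

fun path :: "('o, 'm) cat_data \<Rightarrow> 'm set \<Rightarrow> 'o \<Rightarrow> 'm line list \<Rightarrow> 'o \<Rightarrow> bool" where
  "path C \<Sigma> X [] Y \<longleftrightarrow> X \<in> Obj C \<and> X = Y"
| "path C \<Sigma> X (l # ls) Y \<longleftrightarrow> is_line C \<Sigma> l \<and> line_dom C l = X \<and> path C \<Sigma> (line_cod C l) ls Y"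

text \<open>A sequence of lines, in order of traversal, is stored together with its domain and its
  codomain, so that the empty sequences at distinct objects are distinct.\<close>

type_synonym ('o, 'm) seq = "'o \<times> 'm line list \<times> 'o"

fun seq_dom :: "('o, 'm) seq \<Rightarrow> 'o" where "seq_dom (X, p, Y) = X"

fun seq_cod :: "('o, 'm) seq \<Rightarrow> 'o" where "seq_cod (X, p, Y) = Y"

fun is_seq :: "('o, 'm) cat_data \<Rightarrow> 'm set \<Rightarrow> ('o, 'm) seq \<Rightarrow> bool" where
  "is_seq C \<Sigma> (X, p, Y) \<longleftrightarrow> path C \<Sigma> X p Y"

fun seq_append :: "('o, 'm) seq \<Rightarrow> ('o, 'm) seq \<Rightarrow> ('o, 'm) seq" where
  "seq_append (X, p, Y) (X', q, Z) = (X, p @ q, Z)"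

inductive repl :: "('o, 'm) cat_data \<Rightarrow> 'm set \<Rightarrow> 'm line list \<Rightarrow> 'm line list \<Rightarrow> bool"
  for C :: "('o, 'm) cat_data" and \<Sigma> :: "'m set" where
  repl_comp: "\<lbrakk>a \<in> Mor C; a' \<in> Mor C; Cod C a = Dom C a'\<rbrakk>
    \<Longrightarrow> repl C \<Sigma> [Fwd a, Fwd a'] [Fwd (Comp C a' a)]"
| repl_inv_left: "d \<in> \<Sigma> \<Longrightarrow> repl C \<Sigma> [Bwd d, Fwd d] []"
| repl_inv_right: "d \<in> \<Sigma> \<Longrightarrow> repl C \<Sigma> [Fwd d, Bwd d] []"
| repl_ident: "X \<in> Obj C \<Longrightarrow> repl C \<Sigma> [Fwd (Ident C X)] []"

inductive seq_step :: "('o, 'm) cat_data \<Rightarrow> 'm set \<Rightarrow> ('o, 'm) seq \<Rightarrow> ('o, 'm) seq \<Rightarrow> bool"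
  for C :: "('o, 'm) cat_data" and \<Sigma> :: "'m set" where
  "\<lbrakk>repl C \<Sigma> u v; is_seq C \<Sigma> (X, p @ u @ q, Y); is_seq C \<Sigma> (X, p @ v @ q, Y)\<rbrakk>
    \<Longrightarrow> seq_step C \<Sigma> (X, p @ u @ q, Y) (X, p @ v @ q, Y)"

definition seq_equiv :: "('o, 'm) cat_data \<Rightarrow> 'm set \<Rightarrow> ('o, 'm) seq \<Rightarrow> ('o, 'm) seq \<Rightarrow> bool" where
  "seq_equiv C \<Sigma> = equivclp (seq_step C \<Sigma>)"

definition seq_class :: "('o, 'm) cat_data \<Rightarrow> 'm set \<Rightarrow> ('o, 'm) seq \<Rightarrow> ('o, 'm) seq set" where
  "seq_class C \<Sigma> s = {t. is_seq C \<Sigma> t \<and> seq_equiv C \<Sigma> s t}"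

definition fractions :: "('o, 'm) cat_data \<Rightarrow> 'm set \<Rightarrow> ('o, 'm) seq set set" where
  "fractions C \<Sigma> = {seq_class C \<Sigma> s | s. is_seq C \<Sigma> s}"

text \<open>All members of a fraction have the same domain and the same codomain, and the class of a
  concatenation does not depend on the chosen representatives (see the lemmas below); hence
  \<open>the_elem\<close> is applied to a singleton, and the union in the composition is a single class.\<close>

definition localization :: "('o, 'm) cat_data \<Rightarrow> 'm set \<Rightarrow> ('o, ('o, 'm) seq set) cat_data" where
  "localization C \<Sigma> =
    \<lparr> Obj = Obj C,
      Mor = fractions C \<Sigma>,
      Dom = (\<lambda>F. the_elem (seq_dom ` F)),
      Cod = (\<lambda>F. the_elem (seq_cod ` F)),
      Ident = (\<lambda>X. seq_class C \<Sigma> (X, [], X)),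
      Comp = (\<lambda>G F. \<Union>s \<in> F. \<Union>t \<in> G. seq_class C \<Sigma> (seq_append s t)) \<rparr>"


section \<open>Dilatation\<close>

definition center :: "('o, 'm) cat_data \<Rightarrow> 'i set \<Rightarrow> ('i \<Rightarrow> 'm set) \<Rightarrow> ('i \<Rightarrow> 'm) \<Rightarrow> bool" where
  "center C I N d \<longleftrightarrow> (\<forall>i \<in> I. d i \<in> Mor C \<and> sieve_over C (Cod C (d i)) (N i))"

text \<open>The list \<open>w\<close> consists of the pairs \<open>(i\<^sub>j, n\<^sub>j)\<close>; composability is enforced by \<open>is_seq\<close>.\<close>

definition dil_seq ::
  "('o, 'm) cat_data \<Rightarrow> 'i set \<Rightarrow> ('i \<Rightarrow> 'm set) \<Rightarrow> ('i \<Rightarrow> 'm) \<Rightarrow> ('o, 'm) seq \<Rightarrow> bool" where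
  "dil_seq C I N d s \<longleftrightarrow> is_seq C (d ` I) s \<and>
    (\<exists>X w a Y. s = (X, concat (map (\<lambda>(i, n). [Fwd n, Bwd (d i)]) w) @ [Fwd a], Y) \<and>
       (\<forall>(i, n) \<in> set w. i \<in> I \<and> n \<in> N i) \<and> a \<in> Mor C)"

definition dil_fractions ::
  "('o, 'm) cat_data \<Rightarrow> 'i set \<Rightarrow> ('i \<Rightarrow> 'm set) \<Rightarrow> ('i \<Rightarrow> 'm) \<Rightarrow> ('o, 'm) seq set set" where
  "dil_fractions C I N d = {F \<in> fractions C (d ` I). \<exists>s \<in> F. dil_seq C I N d s}"

definition dilatation ::
  "('o, 'm) cat_data \<Rightarrow> 'i set \<Rightarrow> ('i \<Rightarrow> 'm set) \<Rightarrow> ('i \<Rightarrow> 'm) \<Rightarrow> ('o, ('o, 'm) seq set) cat_data" where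
  "dilatation C I N d = (localization C (d ` I))\<lparr>Mor := dil_fractions C I N d\<rparr>"


section \<open>Well-definedness\<close>

lemma path_append:
  "category C \<Longrightarrow> \<Sigma> \<subseteq> Mor C \<Longrightarrow>
    path C \<Sigma> X (p @ q) Z \<longleftrightarrow> (\<exists>Y. path C \<Sigma> X p Y \<and> path C \<Sigma> Y q Z)"
proof (induction p arbitrary: X)
  case Nil
  have "path C \<Sigma> X q Z \<Longrightarrow> X \<in> Obj C"
    using Nil by (cases q; cases "hd q") (auto simp: category.Dom_in category.Cod_in)
  then show ?case by auto
qed auto

lemma seq_append_is_seq:
  assumes "category C" "\<Sigma> \<subseteq> Mor C" "is_seq C \<Sigma> s" "is_seq C \<Sigma> t" "seq_cod s = seq_dom t"
  shows "is_seq C \<Sigma> (seq_append s t)"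
  using assms by (cases s; cases t) (auto simp: path_append)

lemma seq_equiv_refl: "seq_equiv C \<Sigma> s s"
  by (simp add: seq_equiv_def)

lemma seq_equiv_sym: "seq_equiv C \<Sigma> s t \<Longrightarrow> seq_equiv C \<Sigma> t s"
  by (simp add: seq_equiv_def equivclp_sym)

lemma seq_equiv_trans: "seq_equiv C \<Sigma> s t \<Longrightarrow> seq_equiv C \<Sigma> t u \<Longrightarrow> seq_equiv C \<Sigma> s u"
  unfolding seq_equiv_def by (rule equivclp_trans)

lemma seq_step_equiv: "seq_step C \<Sigma> s t \<Longrightarrow> seq_equiv C \<Sigma> s t"
  unfolding seq_equiv_def by (rule r_into_equivclp)

lemma seq_step_ends: "seq_step C \<Sigma> s t \<Longrightarrow> seq_dom s = seq_dom t \<and> seq_cod s = seq_cod t"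
  by (auto elim: seq_step.cases)

lemma seq_equiv_ends: "seq_equiv C \<Sigma> s t \<Longrightarrow> seq_dom s = seq_dom t \<and> seq_cod s = seq_cod t"
  unfolding seq_equiv_def
proof (induction rule: equivclp_induct)
  case (step y z)
  then show ?case using seq_step_ends[of C \<Sigma> y z] seq_step_ends[of C \<Sigma> z y] by auto
qed simp

lemma seq_step_append_right:
  assumes "category C" "\<Sigma> \<subseteq> Mor C" "seq_step C \<Sigma> s s'" "is_seq C \<Sigma> t" "seq_cod s = seq_dom t"
  shows "seq_step C \<Sigma> (seq_append s t) (seq_append s' t)"
  using assms(3)
proof cases
  case (1 u v X p q Y)
  obtain r Z where t: "t = (Y, r, Z)" using 1(1) assms(5) by (cases t) auto
  have "is_seq C \<Sigma> (seq_append s t)" "is_seq C \<Sigma> (seq_append s' t)"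
    using assms 1 by (auto intro!: seq_append_is_seq)
  then show ?thesis
    using seq_step.intros[OF 1(3), of X p "q @ r" Z] 1 t by simp
qed

lemma seq_step_append_left:
  assumes "category C" "\<Sigma> \<subseteq> Mor C" "seq_step C \<Sigma> t t'" "is_seq C \<Sigma> s" "seq_cod s = seq_dom t"
  shows "seq_step C \<Sigma> (seq_append s t) (seq_append s t')"
  using assms(3)
proof cases
  case (1 u v X p q Y)
  obtain r Z where s: "s = (Z, r, X)" using 1(1) assms(5) by (cases s) auto
  have "is_seq C \<Sigma> (seq_append s t)" "is_seq C \<Sigma> (seq_append s t')"
    using assms 1 by (auto intro!: seq_append_is_seq)
  then show ?thesis
    using seq_step.intros[OF 1(3), of Z "r @ p" q Y] 1 s by simp
qed

lemma seq_equiv_append: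
  assumes C: "category C" "\<Sigma> \<subseteq> Mor C" and "seq_equiv C \<Sigma> s s'" "seq_equiv C \<Sigma> t t'"
    and s': "is_seq C \<Sigma> s'" and t: "is_seq C \<Sigma> t" and st: "seq_cod s = seq_dom t"
  shows "seq_equiv C \<Sigma> (seq_append s t) (seq_append s' t')"
proof -
  have "seq_equiv C \<Sigma> (seq_append s t) (seq_append s' t)"
    using assms(3) unfolding seq_equiv_def
  proof (induction rule: equivclp_induct)
    case (step y z)
    have "seq_cod y = seq_dom t" "seq_cod z = seq_dom t"
      using step st seq_equiv_ends[of C \<Sigma> s y] seq_step_ends[of C \<Sigma> y z] seq_step_ends[of C \<Sigma> z y]
      by (auto simp: seq_equiv_def)
    then show ?case
      using step seq_step_append_right[OF C _ t, of y z] seq_step_append_right[OF C _ t, of z y]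
      by (metis equivclp_into_equivclp)
  qed simp
  moreover have "seq_equiv C \<Sigma> (seq_append s' t) (seq_append s' t')"
    using assms(4) unfolding seq_equiv_def
  proof (induction rule: equivclp_induct)
    case (step y z)
    have "seq_cod s' = seq_dom y" "seq_cod s' = seq_dom z"
      using step st seq_equiv_ends[of C \<Sigma> t y] seq_step_ends[of C \<Sigma> y z] seq_step_ends[of C \<Sigma> z y]
        seq_equiv_ends[OF assms(3)]
      by (auto simp: seq_equiv_def)
    then show ?case
      using step seq_step_append_left[OF C _ s', of y z] seq_step_append_left[OF C _ s', of z y]
      by (metis equivclp_into_equivclp)
  qed simp
  ultimately show ?thesis by (rule seq_equiv_trans)
qed

lemma seq_class_self: "is_seq C \<Sigma> s \<Longrightarrow> s \<in> seq_class C \<Sigma> s"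
  by (simp add: seq_class_def seq_equiv_refl)

lemma seq_class_eqI: "seq_equiv C \<Sigma> s t \<Longrightarrow> seq_class C \<Sigma> s = seq_class C \<Sigma> t"
  unfolding seq_class_def by (blast intro: seq_equiv_trans seq_equiv_sym)

lemma fraction_ends:
  assumes "is_seq C \<Sigma> s"
  shows "Dom (localization C \<Sigma>) (seq_class C \<Sigma> s) = seq_dom s"
    and "Cod (localization C \<Sigma>) (seq_class C \<Sigma> s) = seq_cod s"
proof -
  have "seq_dom ` seq_class C \<Sigma> s = {seq_dom s}" "seq_cod ` seq_class C \<Sigma> s = {seq_cod s}"
    using seq_class_self[OF assms] seq_equiv_ends[of C \<Sigma> s] by (force simp: seq_class_def)+
  then show "Dom (localization C \<Sigma>) (seq_class C \<Sigma> s) = seq_dom s"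
    and "Cod (localization C \<Sigma>) (seq_class C \<Sigma> s) = seq_cod s"
    by (simp_all add: localization_def)
qed

lemma fraction_comp:
  assumes C: "category C" "\<Sigma> \<subseteq> Mor C" and s: "is_seq C \<Sigma> s" and t: "is_seq C \<Sigma> t"
    and st: "seq_cod s = seq_dom t"
  shows "Comp (localization C \<Sigma>) (seq_class C \<Sigma> t) (seq_class C \<Sigma> s) = seq_class C \<Sigma> (seq_append s t)"
proof -
  have "seq_class C \<Sigma> (seq_append s' t') = seq_class C \<Sigma> (seq_append s t)"
    if "s' \<in> seq_class C \<Sigma> s" "t' \<in> seq_class C \<Sigma> t" for s' t'
    using that seq_equiv_append[OF C _ _ _ t st, of s' t']
    by (auto simp: seq_class_def[of _ _ s] seq_class_def[of _ _ t] dest: seq_class_eqI)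
  then have "(\<Union>s' \<in> seq_class C \<Sigma> s. \<Union>t' \<in> seq_class C \<Sigma> t. seq_class C \<Sigma> (seq_append s' t'))
      = seq_class C \<Sigma> (seq_append s t)"
    using seq_class_self[OF s] seq_class_self[OF t] by blast
  then show ?thesis by (simp add: localization_def)
qed

lemma is_seq_ends:
  "category C \<Longrightarrow> \<Sigma> \<subseteq> Mor C \<Longrightarrow> is_seq C \<Sigma> s \<Longrightarrow> seq_dom s \<in> Obj C \<and> seq_cod s \<in> Obj C"
proof -
  assume C: "category C" "\<Sigma> \<subseteq> Mor C" and s: "is_seq C \<Sigma> s"
  obtain X p Y where s': "s = (X, p, Y)" by (cases s)
  have "path C \<Sigma> X ([] @ p @ []) Y" using s s' by simp
  then show ?thesis unfolding path_append[OF C] s' by auto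
qed

theorem category_localization:
  assumes C: "category C" "\<Sigma> \<subseteq> Mor C"
  shows "category (localization C \<Sigma>)"
proof -
  let ?L = "localization C \<Sigma>"
  have Mor: "f \<in> Mor ?L \<longleftrightarrow> (\<exists>s. is_seq C \<Sigma> s \<and> f = seq_class C \<Sigma> s)" for f
    by (auto simp: localization_def fractions_def)
  have Obj: "Obj ?L = Obj C" by (simp add: localization_def)
  have Ident: "Ident ?L X = seq_class C \<Sigma> (X, [], X)" for X by (simp add: localization_def)
  have unit: "X \<in> Obj C \<Longrightarrow> is_seq C \<Sigma> (X, [], X)" for X by simp
  note simps = fraction_ends fraction_comp[OF C] seq_append_is_seq[OF C]
  show ?thesis
  proof
    fix f assume "f \<in> Mor ?L"
    then obtain s where s: "is_seq C \<Sigma> s" "f = seq_class C \<Sigma> s" using Mor by blast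
    note e = is_seq_ends[OF C s(1)]
    show "Dom ?L f \<in> Obj ?L" "Cod ?L f \<in> Obj ?L" using s e by (simp_all add: simps Obj)
    show "Comp ?L f (Ident ?L (Dom ?L f)) = f"
      using s e by (cases s) (simp add: simps Ident del: is_seq.simps add: unit)
    show "Comp ?L (Ident ?L (Cod ?L f)) f = f"
      using s e by (cases s) (simp add: simps Ident del: is_seq.simps add: unit)
  next
    fix X assume "X \<in> Obj ?L"
    then have X: "is_seq C \<Sigma> (X, [], X)" by (simp add: Obj)
    show "Ident ?L X \<in> Mor ?L" using X Mor Ident by blast
    show "Dom ?L (Ident ?L X) = X" "Cod ?L (Ident ?L X) = X"
      using fraction_ends[OF X] by (simp_all add: Ident)
  next
    fix f g assume "f \<in> Mor ?L" "g \<in> Mor ?L" and fg: "Cod ?L f = Dom ?L g"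
    then obtain s t where s: "is_seq C \<Sigma> s" "f = seq_class C \<Sigma> s"
      and t: "is_seq C \<Sigma> t" "g = seq_class C \<Sigma> t" using Mor by meson
    have st: "seq_cod s = seq_dom t" using fg s t by (simp add: simps)
    then have a: "is_seq C \<Sigma> (seq_append s t)" using s t simps(4) by blast
    have c: "Comp ?L g f = seq_class C \<Sigma> (seq_append s t)" using s t st by (simp add: simps)
    show "Comp ?L g f \<in> Mor ?L" using a c Mor by blast
    have "seq_dom (seq_append s t) = seq_dom s" "seq_cod (seq_append s t) = seq_cod t"
      by (cases s; cases t; simp)+
    then show "Dom ?L (Comp ?L g f) = Dom ?L f" "Cod ?L (Comp ?L g f) = Cod ?L g"
      using a c s t by (simp_all add: simps)
  next
    fix f g h assume "f \<in> Mor ?L" "g \<in> Mor ?L" "h \<in> Mor ?L"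
      and fg: "Cod ?L f = Dom ?L g" and gh: "Cod ?L g = Dom ?L h"
    then obtain s t u where s: "is_seq C \<Sigma> s" "f = seq_class C \<Sigma> s"
      and t: "is_seq C \<Sigma> t" "g = seq_class C \<Sigma> t"
      and u: "is_seq C \<Sigma> u" "h = seq_class C \<Sigma> u" using Mor by meson
    have e: "seq_cod s = seq_dom t" "seq_cod t = seq_dom u" using fg gh s t u by (simp_all add: simps)
    have a: "seq_append s (seq_append t u) = seq_append (seq_append s t) u"
      "seq_cod (seq_append s t) = seq_cod t" "seq_dom (seq_append t u) = seq_dom t"
      by (cases s; cases t; cases u; simp)+
    show "Comp ?L h (Comp ?L g f) = Comp ?L (Comp ?L h g) f"
      using s t u e a by (simp add: simps)
  qed
qed

lemma center_subset: "center C I N d \<Longrightarrow> d ` I \<subseteq> Mor C"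
  by (auto simp: center_def)

lemma dil_seq_append:
  assumes C: "category C" and N: "center C I N d" and s: "dil_seq C I N d s" and t: "dil_seq C I N d t"
    and st: "seq_cod s = seq_dom t"
  shows "\<exists>r. dil_seq C I N d r \<and> seq_equiv C (d ` I) (seq_append s t) r"
proof -
  let ?\<Sigma> = "d ` I" and ?b = "\<lambda>w. concat (map (\<lambda>(i, n). [Fwd n, Bwd (d i)]) w)"
  have S: "?\<Sigma> \<subseteq> Mor C" using N by (rule center_subset)
  obtain X v a Y where s': "s = (X, ?b v @ [Fwd a], Y)" "\<forall>(i, n) \<in> set v. i \<in> I \<and> n \<in> N i" "a \<in> Mor C"
    and si: "is_seq C ?\<Sigma> s" using s unfolding dil_seq_def by blast
  obtain Y' w b Z where t': "t = (Y', ?b w @ [Fwd b], Z)" "\<forall>(i, n) \<in> set w. i \<in> I \<and> n \<in> N i" "b \<in> Mor C"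
    and ti: "is_seq C ?\<Sigma> t" using t unfolding dil_seq_def by blast
  have aY: "Cod C a = Y" and Y': "Y' = Y" using si s' st t' by (auto simp: path_append[OF C S])
  have st_i: "is_seq C ?\<Sigma> (seq_append s t)" using seq_append_is_seq[OF C S si ti st] .
  have key: "seq_equiv C ?\<Sigma> (seq_append s t) (X, ?b v @ [Fwd (Comp C c a)] @ q, Z) \<and>
      is_seq C ?\<Sigma> (X, ?b v @ [Fwd (Comp C c a)] @ q, Z)"
    if c: "c \<in> Mor C" "?b w @ [Fwd b] = Fwd c # q" for c q
  proof -
    have ca: "Dom C c = Cod C a" using ti t' c(2) aY Y' by simp
    have r: "repl C ?\<Sigma> [Fwd a, Fwd c] [Fwd (Comp C c a)]"
      using s'(3) c ca by (auto intro: repl_comp)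
    have q: "seq_append s t = (X, ?b v @ [Fwd a, Fwd c] @ q, Z)" using s' t' c by simp
    have p: "is_seq C ?\<Sigma> (X, ?b v @ [Fwd (Comp C c a)] @ q, Z)"
      using st_i[unfolded q] s'(3) c ca category.Comp_in[OF C] category.Dom_Comp[OF C] category.Cod_Comp[OF C]
      by (auto simp: path_append[OF C S])
    show ?thesis using p seq_step_equiv[OF seq_step.intros[OF r st_i[unfolded q] p]] q by simp
  qed
  show ?thesis
  proof (cases w)
    case Nil
    have "dil_seq C I N d (X, ?b v @ [Fwd (Comp C b a)], Z)"
      unfolding dil_seq_def using key[of b "[]"] Nil t'(3) s'
      by (auto simp: path_append[OF C S])
    then show ?thesis using key[of b "[]"] Nil t'(3) by auto
  next
    case (Cons x w')
    obtain i n where x: "x = (i, n)" by (cases x)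
    have i: "i \<in> I" "n \<in> N i" using t' Cons x by auto
    have nM: "n \<in> Mor C" using i N by (auto simp: center_def sieve_over_def sieve_def)
    let ?r = "(X, ?b (v @ (i, Comp C n a) # w') @ [Fwd b], Z)"
    have k: "seq_equiv C ?\<Sigma> (seq_append s t) ?r" "is_seq C ?\<Sigma> ?r"
      using key[OF nM, of "Bwd (d i) # ?b w' @ [Fwd b]"] Cons x by simp_all
    have "Cod C a = Dom C n" using ti t' Cons x aY Y' by simp
    then have "Comp C n a \<in> N i"
      using i N s'(3) by (auto simp: center_def sieve_over_def sieve_def)
    then have "\<forall>(i, n) \<in> set (v @ (i, Comp C n a) # w'). i \<in> I \<and> n \<in> N i"
      using s'(2) t'(2) Cons i by auto
    then have "dil_seq C I N d ?r" unfolding dil_seq_def using k(2) t'(3) by blast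
    then show ?thesis using k(1) by blast
  qed
qed

lemma dil_fractions_iff:
  "F \<in> dil_fractions C I N d \<longleftrightarrow> (\<exists>s. dil_seq C I N d s \<and> F = seq_class C (d ` I) s)"
proof
  assume "F \<in> dil_fractions C I N d"
  then obtain r s where "F = seq_class C (d ` I) r" "s \<in> F" "dil_seq C I N d s"
    unfolding dil_fractions_def fractions_def by blast
  then show "\<exists>s. dil_seq C I N d s \<and> F = seq_class C (d ` I) s"
    using seq_class_eqI[of C "d ` I" r s] unfolding seq_class_def[of C "d ` I" r] by blast
next
  assume "\<exists>s. dil_seq C I N d s \<and> F = seq_class C (d ` I) s"
  then show "F \<in> dil_fractions C I N d"
    unfolding dil_fractions_def fractions_def
    using seq_class_self[of C "d ` I"] dil_seq_def[of C I N d] by blast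
qed

theorem category_dilatation:
  assumes C: "category C" and N: "center C I N d"
  shows "category (dilatation C I N d)"
proof -
  let ?\<Sigma> = "d ` I"
  let ?L = "localization C ?\<Sigma>" and ?D = "dilatation C I N d"
  have S: "?\<Sigma> \<subseteq> Mor C" using N by (rule center_subset)
  interpret L: category ?L using C S by (rule category_localization)
  have D: "Obj ?D = Obj ?L" "Dom ?D = Dom ?L" "Cod ?D = Cod ?L" "Ident ?D = Ident ?L" "Comp ?D = Comp ?L"
    by (simp_all add: dilatation_def)
  have M: "Mor ?D = dil_fractions C I N d" by (simp add: dilatation_def)
  have sub: "f \<in> Mor ?D \<Longrightarrow> f \<in> Mor ?L" for f
    by (auto simp: M dil_fractions_def localization_def)
  have id: "Ident ?L X \<in> Mor ?D" if X: "X \<in> Obj ?L" for X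
  proof -
    have X': "X \<in> Obj C" using X by (simp add: localization_def)
    note I = category.Ident_in[OF C X'] category.Dom_Ident[OF C X'] category.Cod_Ident[OF C X']
    let ?s = "(X, [Fwd (Ident C X)], X)"
    have "seq_step C ?\<Sigma> ?s (X, [], X)"
      using seq_step.intros[OF repl_ident[OF X'], of ?\<Sigma> X "[]" "[]" X] I X' by simp
    then have "seq_class C ?\<Sigma> (X, [], X) = seq_class C ?\<Sigma> ?s"
      by (metis seq_class_eqI seq_step_equiv)
    moreover have "dil_seq C I N d ?s"
      unfolding dil_seq_def using I X' by (auto intro!: exI[of _ "[]"])
    ultimately show ?thesis by (auto simp: M dil_fractions_iff localization_def)
  qed
  have comp: "Comp ?L g f \<in> Mor ?D"
    if f: "f \<in> Mor ?D" and g: "g \<in> Mor ?D" and fg: "Cod ?L f = Dom ?L g" for f g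
  proof -
    obtain s t where s: "dil_seq C I N d s" "f = seq_class C ?\<Sigma> s"
      and t: "dil_seq C I N d t" "g = seq_class C ?\<Sigma> t"
      using f g by (auto simp: M dil_fractions_iff)
    have i: "is_seq C ?\<Sigma> s" "is_seq C ?\<Sigma> t" using s t by (auto simp: dil_seq_def)
    have st: "seq_cod s = seq_dom t" using fg i s t by (simp add: fraction_ends)
    obtain r where "dil_seq C I N d r" "seq_equiv C ?\<Sigma> (seq_append s t) r"
      using dil_seq_append[OF C N s(1) t(1) st] by blast
    then show ?thesis
      unfolding s(2) t(2) fraction_comp[OF C S i st] M dil_fractions_iff by (blast dest: seq_class_eqI)
  qed
  show ?thesis
    by standard (simp_all add: D sub id comp L.Dom_in L.Cod_in L.Dom_Ident L.Cod_Ident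
        L.Dom_Comp L.Cod_Comp L.Comp_Ident L.Ident_Comp L.Comp_assoc)
qed

theorem dilatation_faithful:
  assumes C: "category C" and N: "center C I N d"
  shows "faithful_functor (dilatation C I N d) (localization C (d ` I)) (\<lambda>X. X) (\<lambda>f. f)"
proof -
  have "cat_functor (dilatation C I N d) (localization C (d ` I)) (\<lambda>X. X) (\<lambda>f. f)"
    unfolding cat_functor_def cat_functor_axioms_def
    using category_dilatation[OF C N] category_localization[OF C center_subset[OF N]]
    by (auto simp: dilatation_def dil_fractions_def localization_def)
  then show ?thesis by (simp add: faithful_functor_def)
qed

end

theory Submission
  imports Defs
begin

text \<open>Once every \<open>N i\<close> contains the identity of \<open>Cod C (d i)\<close>, each generator of the localization
  is a dilatation fraction: \<open>l\<^sub>d\<close> equals \<open>Id, l\<^sub>d, Id\<close>. As dilatation fractions are closed under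
  composition, they exhaust the localization.\<close>

text \<open>Cutting the sequence at \<open>Y\<close> supplies the well-formedness of both sides that
  \<open>seq_step\<close> demands. With \<open>p\<close> or \<open>q\<close> empty this strips an
  identity at an end.\<close>

lemma seq_step_ident:
  assumes "category C" and "\<Sigma> \<subseteq> Mor C" and "path C \<Sigma> X p Y" and "path C \<Sigma> Y q Z"
  shows "seq_step C \<Sigma> (X, p @ [Fwd (Ident C Y)] @ q, Z) (X, p @ q, Z)"
proof -
  interpret category C by fact
  have Y: "Y \<in> Obj C"
    using is_seq_ends[OF assms(1,2), of "(X, p, Y)"] assms(3) by simp
  have "is_seq C \<Sigma> (X, p @ [Fwd (Ident C Y)] @ q, Z)"
    and "is_seq C \<Sigma> (X, p @ [] @ q, Z)"
    using assms Y by (auto simp: path_append Ident_in Dom_Ident Cod_Ident)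
  from seq_step.intros[OF repl_ident[OF Y] this] show ?thesis by simp
qed

text \<open>A forward line is the case of no fractions. For a backward line, the identity before it
  is an admissible numerator by \<open>id\<close>, and the one after it is the closing
  morphism.\<close>

lemma line_equiv_dil_seq:
  assumes C: "category C" and N: "center C I N d"
    and id: "\<And>i. i \<in> I \<Longrightarrow> Ident C (Cod C (d i)) \<in> N i"
    and l: "is_line C (d ` I) l"
  shows "\<exists>r. dil_seq C I N d r \<and> seq_equiv C (d ` I) (line_dom C l, [l], line_cod C l) r"
proof (cases l)
  case (Fwd a)
  then have "dil_seq C I N d (line_dom C l, [l], line_cod C l)"
    using l C by (auto simp: dil_seq_def category.Cod_in intro!: exI[of _ "[]"])
  then show ?thesis using seq_equiv_refl by blast
next
  case (Bwd e)
  then obtain i where i: "i \<in> I" "e = d i" using l by auto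
  interpret category C by fact
  let ?\<Sigma> = "d ` I" and ?X = "Cod C e" and ?Y = "Dom C e"
  have S: "?\<Sigma> \<subseteq> Mor C" using N by (rule center_subset)
  have X: "?X \<in> Obj C" and Y: "?Y \<in> Obj C"
    using S i by (auto simp: Dom_in Cod_in)
  let ?r = "(?X, [Fwd (Ident C ?X), Bwd e, Fwd (Ident C ?Y)], ?Y)"
  have "is_seq C ?\<Sigma> ?r"
    using i X Y by (simp add: Ident_in Dom_Ident Cod_Ident)
  then have "dil_seq C I N d ?r"
    \<comment> \<open>The single pair accounts for the first two lines of \<open>?r\<close>; the
      last line is the mandatory final morphism.\<close>
    using i id Y by (auto simp: dil_seq_def Ident_in intro!: exI[of _ "[(i, Ident C ?X)]"])
  moreover have "seq_step C ?\<Sigma> ?r (?X, [Bwd e, Fwd (Ident C ?Y)], ?Y)"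
    using seq_step_ident[OF C S, of ?X "[]" ?X "[Bwd e, Fwd (Ident C ?Y)]" ?Y] i X Y
    by (simp add: Ident_in Dom_Ident Cod_Ident)
  moreover have "seq_step C ?\<Sigma> (?X, [Bwd e, Fwd (Ident C ?Y)], ?Y) (?X, [Bwd e], ?Y)"
    using seq_step_ident[OF C S, of ?X "[Bwd e]" ?Y "[]" ?Y] i Y by simp
  ultimately have "dil_seq C I N d ?r \<and> seq_equiv C ?\<Sigma> (?X, [Bwd e], ?Y) ?r"
    by (blast intro: seq_equiv_sym seq_equiv_trans seq_step_equiv)
  then show ?thesis unfolding Bwd line_dom.simps line_cod.simps by blast
qed

text \<open>Induction on the path, joining the normal form of the first line to that of the rest by
  \<open>dil_seq_append\<close>.\<close>

lemma path_equiv_dil_seq: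
  assumes C: "category C" and N: "center C I N d"
    and id: "\<And>i. i \<in> I \<Longrightarrow> Ident C (Cod C (d i)) \<in> N i"
    and "path C (d ` I) X p Y"
  shows "\<exists>r. dil_seq C I N d r \<and> seq_equiv C (d ` I) (X, p, Y) r"
  using assms(4)
proof (induction p arbitrary: X)
  case Nil
  interpret category C by fact
  have X: "X \<in> Obj C" and Y: "Y = X" using Nil by auto
  \<comment> \<open>The empty sequence itself lacks the closing morphism, so an identity stands in
    for it.\<close>
  have "seq_step C (d ` I) (X, [Fwd (Ident C X)], X) (X, [], X)"
    using seq_step_ident[OF C center_subset[OF N], of X "[]" X "[]" X] X by simp
  moreover have "dil_seq C I N d (X, [Fwd (Ident C X)], X)"
    using X by (auto simp: dil_seq_def Ident_in Dom_Ident Cod_Ident intro!: exI[of _ "[]"])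
  ultimately show ?case
    unfolding Y by (blast intro: seq_equiv_sym seq_step_equiv)
next
  case (Cons l p)
  let ?\<Sigma> = "d ` I" and ?Z = "line_cod C l"
  have S: "?\<Sigma> \<subseteq> Mor C" using N by (rule center_subset)
  have l: "is_line C ?\<Sigma> l" and X: "line_dom C l = X" and p: "path C ?\<Sigma> ?Z p Y"
    using Cons.prems by auto
  obtain s where s: "dil_seq C I N d s" "seq_equiv C ?\<Sigma> (X, [l], ?Z) s"
    using line_equiv_dil_seq[OF C N id l] X by auto
  obtain t where t: "dil_seq C I N d t" "seq_equiv C ?\<Sigma> (?Z, p, Y) t"
    using Cons.IH[OF p] by auto
  \<comment> \<open>Equivalence preserves endpoints, so the new representatives are still composable
    at \<open>?Z\<close>.\<close>
  have "seq_cod s = seq_dom t"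
    using seq_equiv_ends[OF s(2)] seq_equiv_ends[OF t(2)] by simp
  then obtain r where r: "dil_seq C I N d r" "seq_equiv C ?\<Sigma> (seq_append s t) r"
    using dil_seq_append[OF C N s(1) t(1)] by blast
  \<comment> \<open>The left factor is replaced first; \<open>s\<close> must then be a genuine
    sequence while the right factor is rewritten behind it.\<close>
  have "is_seq C ?\<Sigma> s" using s(1) by (simp add: dil_seq_def)
  then have "seq_equiv C ?\<Sigma> (seq_append (X, [l], ?Z) (?Z, p, Y)) (seq_append s t)"
    using p by (intro seq_equiv_append[OF C S s(2) t(2)]) simp_all
  then have "seq_equiv C ?\<Sigma> (X, l # p, Y) r"
    using seq_equiv_trans[OF _ r(2)] by simp
  then show ?case using r(1) by blast
qed

text \<open>The two records can differ only in \<open>Mor\<close>, so it is enough that every class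
  has a dilatation representative. For sieves over \<open>Cod C (d i)\<close>, \<open>id\<close> is
  maximality in disguise: composing the identity with any morphism into that object returns the
  morphism.\<close>

lemma dilatation_eq_localization:
  assumes C: "category C" and N: "center C I N d"
    and id: "\<And>i. i \<in> I \<Longrightarrow> Ident C (Cod C (d i)) \<in> N i"
  shows "dilatation C I N d = localization C (d ` I)"
proof -
  have "seq_class C (d ` I) s \<in> dil_fractions C I N d" if "is_seq C (d ` I) s" for s
    using that path_equiv_dil_seq[OF C N id]
    by (cases s) (fastforce simp: dil_fractions_iff dest: seq_class_eqI)
  then have "dil_fractions C I N d = fractions C (d ` I)"
    by (auto simp: dil_fractions_def fractions_def)
  then show ?thesis by (simp add: dilatation_def localization_def)
qed

theorem fact2p15:
  fixes C :: "('o, 'm) cat_data"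
    and I :: "'i set"
    and N :: "'i \<Rightarrow> 'm set"
    and d :: "'i \<Rightarrow> 'm"
  assumes "category C"
    and "center C I N d"
    and "\<And>i. i \<in> I \<Longrightarrow> N i = maximal_sieve C (Cod C (d i))"
  shows "full_functor (dilatation C I N d) (localization C (d ` I)) (\<lambda>X. X) (\<lambda>f. f) \<and>
    dilatation C I N d = localization C (d ` I)"
proof -
  interpret category C by fact
  have "Ident C (Cod C (d i)) \<in> N i" if "i \<in> I" for i
    using that assms(2)
    by (auto simp: assms(3) maximal_sieve_def center_def Cod_in Ident_in Cod_Ident)
  then have "dilatation C I N d = localization C (d ` I)"
    using assms(1,2) by (rule dilatation_eq_localization[rotated 2])
  moreover have "cat_functor (dilatation C I N d) (localization C (d ` I)) (\<lambda>X. X) (\<lambda>f. f)"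
    using dilatation_faithful[OF assms(1,2)] by (simp add: faithful_functor_def)
  \<comment> \<open>Once the categories coincide, the identity maps each Hom set onto itself, which
    is fullness.\<close>
  ultimately show ?thesis by (simp add: full_functor_def)
qed

end
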